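(* Let $m,n,k$ be positive integers with $m+n$ odd. Then the directed (multi)graph $G_{m,n,k}$ is strongly connected, i.e. for every ordered pair of vertices $(t,u)$ there is a directed path from $t$ to $u$.
   Context: Fix positive integers $m,n$ with $m+n$ odd (so $m\neq n$). For $x\in\{m,n\}$ write $\bar x=m+n-x$. For a finite or infinite sequence $s=(s_1,s_2,\dots)$ of positive integers and a letter $x\in\{m,n\}$, let $E(s,x)$ be the concatenation $x^{s_1}\,\bar x^{s_2}\,x^{s_3}\,\bar x^{s_4}\cdots$ (runs of lengths $s_1,s_2,\dots$ with values alternating, starting with $x$; here $y^{r}$ means $r$ copies of $y$). For a finite sequence $s$, let $C(s,x)=x$ if $|s|$ is even and $C(s,x)=\bar x$ if $|s|$ is odd. For $t=t_1t_2\cdots t_k\in\{m,n\}^k$ with $k\ge 2$ define recursively $E(s,t)=E(E(s,t_1),t_2\cdots t_k)$ and $C(s,t)=C(s,t_1)\,C(E(s,t_1),t_2\cdots t_k)$ (concatenation), so $C(s,t)\in\{m,n\}^k$. The graph $G_{m,n,k}$ has vertex set $\{m,n\}^k$ and, for each vertex $t$, exactly two outgoing edges: one from $t$ to $C(m,t)$ and one from $t$ to $C(n,t)$, where $m$ and $n$ are viewed as length-one sequences (for $k=1$ this is a multigraph). *)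

theory Defs
  imports "Graph_Theory.Digraph_Component"
begin

definition bar :: "nat \<Rightarrow> nat \<Rightarrow> nat \<Rightarrow> nat" where
  "bar m n x = m + n - x"

primrec run_expand :: "nat \<Rightarrow> nat \<Rightarrow> nat list \<Rightarrow> nat \<Rightarrow> nat list" where
  "run_expand m n [] x = []"
| "run_expand m n (r # s) x = replicate r x @ run_expand m n s (bar m n x)"

definition next_letter :: "nat \<Rightarrow> nat \<Rightarrow> nat list \<Rightarrow> nat \<Rightarrow> nat" where
  "next_letter m n s x = (if even (length s) then x else bar m n x)"

text \<open>
  The iterated operations \<open>E(s,t)\<close> and \<open>C(s,t)\<close> for a word \<open>t\<close>. They are extended to the
  empty word by \<open>E(s,[]) = s\<close> and \<open>C(s,[]) = []\<close>; on one-letter words this gives back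
  \<open>E(s,x)\<close> and \<open>C(s,x)\<close>.
\<close>

primrec run_expand_word :: "nat \<Rightarrow> nat \<Rightarrow> nat list \<Rightarrow> nat list \<Rightarrow> nat list" where
  "run_expand_word m n s [] = s"
| "run_expand_word m n s (x # t) = run_expand_word m n (run_expand m n s x) t"

primrec next_word :: "nat \<Rightarrow> nat \<Rightarrow> nat list \<Rightarrow> nat list \<Rightarrow> nat list" where
  "next_word m n s [] = []"
| "next_word m n s (x # t) = next_letter m n s x # next_word m n (run_expand m n s x) t"

definition words :: "nat \<Rightarrow> nat \<Rightarrow> nat \<Rightarrow> nat list set" where
  "words m n k = {t. set t \<subseteq> {m, n} \<and> length t = k}"

text \<open>
  The arc \<open>(t, a)\<close> runs from \<open>t\<close> to \<open>C(a,t)\<close>, so the two arcs leaving \<open>t\<close> are distinct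
  even if their heads coincide.
\<close>

definition kgraph :: "nat \<Rightarrow> nat \<Rightarrow> nat \<Rightarrow> (nat list, nat list \<times> nat) pre_digraph" where
  "kgraph m n k =
    \<lparr> verts = words m n k,
      arcs = words m n k \<times> {m, n},
      tail = fst,
      head = (\<lambda>(t, a). next_word m n [a] t) \<rparr>"

lemma length_next_word [simp]: "length (next_word m n s t) = length t"
  by (induction t arbitrary: s) auto

lemma set_next_word: "set t \<subseteq> {m, n} \<Longrightarrow> set (next_word m n s t) \<subseteq> {m, n}"
  by (induction t arbitrary: s) (auto simp: next_letter_def bar_def)

lemma fin_digraph_kgraph: "fin_digraph (kgraph m n k)"
proof
  show "finite (verts (kgraph m n k))" "finite (arcs (kgraph m n k))"
    by (auto simp: kgraph_def words_def finite_lists_length_eq)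
next
  fix e assume "e \<in> arcs (kgraph m n k)"
  then show "tail (kgraph m n k) e \<in> verts (kgraph m n k)"
    "head (kgraph m n k) e \<in> verts (kgraph m n k)"
    using set_next_word[of "fst e" m n "[snd e]"]
    by (auto simp: kgraph_def words_def)
qed

end

theory Submission
  imports Defs "HOL-Number_Theory.Cong"
begin

text \<open>
  Write \<open>\<phi>\<^sub>s\<close> for the map \<open>t \<mapsto> C(s,t)\<close> and \<open>x'\<close> for the letter other than \<open>x\<close>. Since
  \<open>\<phi>\<^sub>a(x t) = x' \<phi>\<^sub>x\<^sup>a(t)\<close>, these maps act on the binary rooted tree of words, and \<open>\<phi>\<^sub>s\<close> has order
  dividing \<open>2\<^sup>k\<close> on words of length \<open>k\<close>. Hence reachability is an equivalence relation. Moving from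
  \<open>x t\<close> with input \<open>m\<close> and with input \<open>n\<close> shows that \<open>x' \<phi>\<^sub>x\<^sup>m(t)\<close> and \<open>x' \<phi>\<^sub>x\<^sup>n(t)\<close> are equivalent. As
  \<open>m - n\<close> is odd and \<open>\<phi>\<^sub>x\<close> has 2-power order, \<open>x' t\<close> and \<open>x' \<phi>\<^sub>x(t)\<close> are equivalent; going through
  the other subtree, so are \<open>x t\<close> and \<open>x \<phi>\<^sub>x(t)\<close>. Thus the whole action on words of length \<open>k\<close> is
  available below each first letter, and induction on \<open>k\<close> applies.
\<close>

section \<open>Composition of inputs and two-power order\<close>

lemma bar_mem: "x \<in> {m, n} \<Longrightarrow> bar m n x \<in> {m, n}"
  by (auto simp: bar_def)

lemma bar_bar: "x \<in> {m, n} \<Longrightarrow> bar m n (bar m n x) = x"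
  by (auto simp: bar_def)

lemma next_letter_append:
  "x \<in> {m, n} \<Longrightarrow> next_letter m n (s @ s') x = next_letter m n s' (next_letter m n s x)"
  by (auto simp: next_letter_def bar_bar)

lemma next_letter_Cons:
  "x \<in> {m, n} \<Longrightarrow> next_letter m n (r # s) x = next_letter m n s (bar m n x)"
  by (auto simp: next_letter_def bar_bar)

lemma run_expand_append:
  "x \<in> {m, n} \<Longrightarrow>
    run_expand m n (s @ s') x = run_expand m n s x @ run_expand m n s' (next_letter m n s x)"
proof (induction s arbitrary: x)
  case Nil
  then show ?case by (simp add: next_letter_def)
next
  case (Cons r s)
  then show ?case using bar_mem[OF Cons.prems] by (simp add: next_letter_Cons)
qed

text \<open>Concatenated inputs act by composition, so a whole path of arcs is a single application
  of \<open>next_word\<close>.\<close>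

lemma next_word_append:
  "set t \<subseteq> {m, n} \<Longrightarrow> next_word m n (s @ s') t = next_word m n s' (next_word m n s t)"
  by (induction t arbitrary: s s') (auto simp: next_letter_append run_expand_append)

lemma next_word_Nil: "next_word m n [] t = t"
  by (induction t) (auto simp: next_letter_def)

lemma run_expand_concat_replicate:
  assumes "x \<in> {m, n}" "even (length s)"
  shows "run_expand m n (concat (replicate j s)) x = concat (replicate j (run_expand m n s x))"
  using assms by (induction j) (auto simp: run_expand_append next_letter_def)

lemma concat_replicate_double: "concat (replicate (2 * j) s) = concat (replicate j (s @ s))"
  by (induction j) auto

lemma even_length_concat_replicate: "even (length s) \<Longrightarrow> even (length (concat (replicate j s)))"
  by (induction j) auto

text \<open>Doubling \<open>s\<close> makes its length even, so each copy of \<open>s @ s\<close>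
  returns to the first letter \<open>x\<close>. Every copy then expands to the same block, and the
  induction hypothesis applies to that block on the tail.\<close>

lemma next_word_order:
  "set t \<subseteq> {m, n} \<Longrightarrow> next_word m n (concat (replicate (2 ^ length t) s)) t = t"
proof (induction t arbitrary: s)
  case Nil
  then show ?case by simp
next
  case (Cons x t)
  have "even (length (concat (replicate (2 ^ length t) (s @ s))))"
    by (rule even_length_concat_replicate) simp
  moreover have "x \<in> {m, n}" "set t \<subseteq> {m, n}"
    using Cons.prems by auto
  ultimately show ?case
    using Cons.IH
    by (simp add: concat_replicate_double run_expand_concat_replicate next_letter_def
        del: length_concat map_replicate)
qed

lemma concat_replicate_replicate: "concat (replicate i (replicate j x)) = replicate (i * j) x"
  by (induction i) (auto simp: replicate_add)

lemma next_word_replicate_order: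
  assumes "set t \<subseteq> {m, n}" "2 ^ length t dvd i"
  shows "next_word m n (replicate i x) t = t"
  using next_word_order[OF assms(1), of "replicate (i div 2 ^ length t) x"] assms(2)
  by (simp add: concat_replicate_replicate)

section \<open>Reachability as an equivalence relation\<close>

definition word_reach :: "nat \<Rightarrow> nat \<Rightarrow> nat list \<Rightarrow> nat list \<Rightarrow> bool" where
  "word_reach m n t u \<longleftrightarrow> (\<exists>s. set s \<subseteq> {m, n} \<and> next_word m n s t = u)"

lemma word_reach_refl: "word_reach m n t t"
  unfolding word_reach_def by (rule exI[of _ "[]"]) (simp add: next_word_Nil)

lemma word_reach_trans:
  assumes "set t \<subseteq> {m, n}" "word_reach m n t u" "word_reach m n u v"
  shows "word_reach m n t v"
proof -
  obtain s s' where "set s \<subseteq> {m, n}" "next_word m n s t = u"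
    "set s' \<subseteq> {m, n}" "next_word m n s' u = v"
    using assms unfolding word_reach_def by blast
  then have "set (s @ s') \<subseteq> {m, n}" "next_word m n (s @ s') t = v"
    using assms(1) by (auto simp: next_word_append)
  then show ?thesis unfolding word_reach_def by blast
qed

lemma word_reach_sym:
  assumes "set t \<subseteq> {m, n}" "word_reach m n t u"
  shows "word_reach m n u t"
proof -
  obtain s where s: "set s \<subseteq> {m, n}" "next_word m n s t = u"
    using assms unfolding word_reach_def by blast
  \<comment> \<open>After one copy of \<open>s\<close> has led to \<open>u\<close>, the other
    \<open>j\<close> copies complete the period and lead back to \<open>t\<close>.\<close>
  obtain j where j: "2 ^ length t = Suc j"
    by (metis not0_implies_Suc power_not_zero zero_neq_numeral)
  have "next_word m n (concat (replicate j s)) u = t"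
    using next_word_order[OF assms(1), of s] s(2) assms(1) by (simp add: j next_word_append)
  moreover have "set (concat (replicate j s)) \<subseteq> {m, n}"
    using s(1) by auto
  ultimately show ?thesis unfolding word_reach_def by blast
qed

lemma word_reach_step:
  assumes "x \<in> {m, n}" "a \<in> {m, n}"
  shows "word_reach m n (x # t) (bar m n x # next_word m n (replicate a x) t)"
  unfolding word_reach_def
  by (rule exI[of _ "[a]"]) (use assms in \<open>simp add: next_letter_def\<close>)

section \<open>Moves below a fixed first letter\<close>

lemma word_reach_bar_Cons_next_word:
  assumes x: "x \<in> {m, n}" and t: "set t \<subseteq> {m, n}" and mn: "odd (m + n)"
  shows "word_reach m n (bar m n x # t) (bar m n x # next_word m n [x] t)"
proof -
  \<comment> \<open>The exponent \<open>length t\<close> would suffice for the period;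
    \<open>Suc\<close> keeps \<open>N\<close> even when \<open>t\<close> is empty, so that
    \<open>N - 1\<close> is odd and \<open>f\<close> has the parity of \<open>m + n\<close>.\<close>
  define N :: nat where "N = 2 ^ Suc (length t)"
  \<comment> \<open>\<open>f\<close> represents \<open>m - n\<close> modulo \<open>N\<close> without truncated subtraction.\<close>
  define f where "f = n * (N - 1) + m"
  let ?pow = "\<lambda>i. next_word m n (replicate i x)"
  have bx: "bar m n x \<in> {m, n}"
    using x by (rule bar_mem)
  have pow_mem: "set (?pow i v) \<subseteq> {m, n}" if "set v \<subseteq> {m, n}" for i v
    using that by (rule set_next_word)
  have pow_add: "?pow j (?pow i v) = ?pow (i + j) v" if "set v \<subseteq> {m, n}" for i j v
    using that by (simp add: replicate_add next_word_append)
  have reach_f: "word_reach m n (bar m n x # v) (bar m n x # ?pow f v)"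
    if v: "set v \<subseteq> {m, n}" "length v = length t" for v
  proof -
    \<comment> \<open>Here \<open>w\<close> is the preimage of \<open>v\<close> under
      \<open>n\<close> copies of \<open>x\<close>, so that from \<open>x # w\<close> the input
      \<open>n\<close> leads to \<open>v\<close> and the input \<open>m\<close> to
      \<open>?pow f v\<close>, both below the other letter.\<close>
    define w where "w = ?pow (n * (N - 1)) v"
    have w: "set w \<subseteq> {m, n}"
      unfolding w_def using v(1) by (rule pow_mem)
    have "n * (N - 1) + n = n * N"
      by (simp add: N_def algebra_simps)
    then have "?pow n w = v"
      using v by (simp add: w_def pow_add next_word_replicate_order N_def)
    moreover have "?pow m w = ?pow f v"
      using v by (simp add: w_def pow_add f_def)
    ultimately have "word_reach m n (x # w) (bar m n x # v)"
      "word_reach m n (x # w) (bar m n x # ?pow f v)"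
      using word_reach_step[OF x, of n w] word_reach_step[OF x, of m w] by auto
    moreover have "set (x # w) \<subseteq> {m, n}" "set (bar m n x # v) \<subseteq> {m, n}"
      using w x v bx by auto
    ultimately show ?thesis
      by (meson word_reach_sym word_reach_trans)
  qed
  have reach_multiple: "word_reach m n (bar m n x # t) (bar m n x # ?pow (j * f) t)" for j
  proof (induction j)
    case 0
    then show ?case by (simp add: next_word_Nil word_reach_refl)
  next
    case (Suc j)
    have "word_reach m n (bar m n x # ?pow (j * f) t) (bar m n x # ?pow (j * f + f) t)"
      using reach_f[OF pow_mem[OF t]] t by (simp add: pow_add)
    then show ?case
      using word_reach_trans[OF _ Suc.IH] bx t by (simp add: add.commute)
  qed
  have "odd f"
    using mn by (auto simp: f_def N_def)
  then have "coprime f N"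
    by (simp add: N_def)
  \<comment> \<open>With \<open>j\<close> inverse to \<open>f\<close> modulo \<open>N\<close>, the
    power \<open>j * f\<close> differs from a single \<open>x\<close> by a multiple of
    \<open>N\<close>, which acts trivially on \<open>t\<close>.\<close>
  then obtain j where "[f * j = Suc 0] (mod N)"
    using cong_solve_coprime_nat by blast
  then have "(j * f) mod N = 1"
    by (simp add: cong_def N_def mult.commute)
  then have "j * f = (j * f) div N * N + 1"
    by (metis div_mult_mod_eq)
  then have "?pow (j * f) t = ?pow 1 (?pow ((j * f) div N * N) t)"
    using pow_add[OF t] by metis
  also have "\<dots> = next_word m n [x] t"
    using t by (simp add: next_word_replicate_order N_def)
  finally show ?thesis
    using reach_multiple[of j] by simp
qed

lemma word_reach_Cons_next_word:
  assumes x: "x \<in> {m, n}" and y: "y \<in> {m, n}" and t: "set t \<subseteq> {m, n}" and mn: "odd (m + n)"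
  shows "word_reach m n (x # t) (x # next_word m n [y] t)"
proof (cases "y = bar m n x")
  case True
  then show ?thesis
    using word_reach_bar_Cons_next_word[OF y t mn] bar_bar[OF x] by simp
next
  case False
  then have [simp]: "y = x"
    using x y by (auto simp: bar_def)
  \<comment> \<open>The input \<open>n\<close> carries both endpoints into the other subtree, where
    the previous lemma applies. Powers of \<open>x\<close> commute, so the images are linked by one
    \<open>x\<close>; symmetry gives the way back.\<close>
  let ?v = "next_word m n (replicate n x) t"
  have v: "set ?v \<subseteq> {m, n}"
    using t by (rule set_next_word)
  have bx: "bar m n x \<in> {m, n}"
    using x by (rule bar_mem)
  have "word_reach m n (x # t) (bar m n x # ?v)"
    using word_reach_step[OF x, of n] by simp
  moreover have "word_reach m n (bar m n x # ?v) (bar m n x # next_word m n [x] ?v)"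
    using x v mn by (rule word_reach_bar_Cons_next_word)
  moreover have "next_word m n [x] ?v = next_word m n (replicate n x) (next_word m n [x] t)"
    using t by (simp add: next_word_append[symmetric] replicate_append_same)
  moreover have "word_reach m n (x # next_word m n [x] t)
      (bar m n x # next_word m n (replicate n x) (next_word m n [x] t))"
    using word_reach_step[OF x, of n] by simp
  ultimately show ?thesis
    using word_reach_trans word_reach_sym x t v bx set_next_word[OF t, of "[x]"]
    by (smt (verit, ccfv_threshold) \<open>y = x\<close> insert_subset list.simps(15))
qed

lemma word_reach_Cons:
  assumes x: "x \<in> {m, n}" and t: "set t \<subseteq> {m, n}" and mn: "odd (m + n)"
    and tu: "word_reach m n t u"
  shows "word_reach m n (x # t) (x # u)"
proof -
  obtain s where "set s \<subseteq> {m, n}" "next_word m n s t = u"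
    using tu unfolding word_reach_def by blast
  then show ?thesis using t
  proof (induction s arbitrary: t)
    case Nil
    then show ?case by (simp add: next_word_Nil word_reach_refl)
  next
    case (Cons y s)
    have "next_word m n s (next_word m n [y] t) = u"
      using Cons.prems next_word_append[of t m n "[y]" s] by simp
    then have "word_reach m n (x # next_word m n [y] t) (x # u)"
      using Cons.prems set_next_word[of t] by (intro Cons.IH) auto
    moreover have "word_reach m n (x # t) (x # next_word m n [y] t)"
      using Cons.prems x mn by (intro word_reach_Cons_next_word) auto
    ultimately show ?case
      using Cons.prems x word_reach_trans[of "x # t" m n] by simp
  qed
qed

section \<open>Transitivity on words and passage to the graph\<close>

lemma word_reach_all:
  assumes mn: "odd (m + n)"
  shows "set t \<subseteq> {m, n} \<Longrightarrow> set u \<subseteq> {m, n} \<Longrightarrow> length t = length u \<Longrightarrow> word_reach m n t u"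
proof (induction t arbitrary: u)
  case Nil
  then show ?case by (simp add: word_reach_refl)
next
  case (Cons x t)
  obtain y u' where u: "u = y # u'"
    using Cons.prems(3) by (cases u) auto
  have mem: "x \<in> {m, n}" "y \<in> {m, n}" "set t \<subseteq> {m, n}" "set u' \<subseteq> {m, n}"
    using Cons.prems u by auto
  have same: "word_reach m n (x # t) (x # v)" if "set v \<subseteq> {m, n}" "length v = length t" for v
    using mem mn that by (intro word_reach_Cons Cons.IH) auto
  show ?case
  proof (cases "y = x")
    case True
    then show ?thesis
      using same[of u'] mem Cons.prems(3) u by simp
  next
    case False
    then have "bar m n y = x"
      using mem by (auto simp: bar_def)
    \<comment> \<open>One step from \<open>y # u'\<close> switches its first letter to
      \<open>x\<close>; symmetry reverses this step, and \<open>same\<close> reaches its endpoint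
      from \<open>x # t\<close>.\<close>
    let ?v = "next_word m n (replicate n y) u'"
    have "word_reach m n (y # u') (x # ?v)"
      using word_reach_step[OF mem(2), of n u'] \<open>bar m n y = x\<close> by simp
    then have "word_reach m n (x # ?v) (y # u')"
      using mem word_reach_sym[of "y # u'" m n] by simp
    moreover have "word_reach m n (x # t) (x # ?v)"
      using mem Cons.prems(3) u by (intro same set_next_word) auto
    ultimately show ?thesis
      using mem u word_reach_trans[of "x # t" m n] by simp
  qed
qed

lemma kgraph_reachable:
  assumes "t \<in> words m n k" "set s \<subseteq> {m, n}"
  shows "t \<rightarrow>\<^sup>*\<^bsub>kgraph m n k\<^esub> next_word m n s t"
proof -
  interpret fin_digraph "kgraph m n k"
    by (rule fin_digraph_kgraph)
  show ?thesis using assms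
  proof (induction s arbitrary: t)
    case Nil
    then have "t \<in> verts (kgraph m n k)"
      by (simp add: kgraph_def)
    then show ?case
      by (simp add: next_word_Nil)
  next
    case (Cons a s)
    have arc: "(t, a) \<in> arcs (kgraph m n k)"
      using Cons.prems by (simp add: kgraph_def)
    have "t \<rightarrow>\<^bsub>kgraph m n k\<^esub> next_word m n [a] t"
      using in_arcs_imp_in_arcs_ends[OF arc] by (simp add: kgraph_def)
    moreover have "next_word m n [a] t \<rightarrow>\<^sup>*\<^bsub>kgraph m n k\<^esub> next_word m n s (next_word m n [a] t)"
      using Cons.prems set_next_word[of t] by (intro Cons.IH) (auto simp: words_def)
    moreover have "next_word m n s (next_word m n [a] t) = next_word m n (a # s) t"
      using Cons.prems next_word_append[of t m n "[a]" s] by (simp add: words_def)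
    ultimately show ?case
      by (metis adj_reachable_trans)
  qed
qed

theorem theorem2p3:
  fixes m n k :: nat
  assumes "m > 0" and "n > 0" and "k > 0" and "odd (m + n)"
  shows "strongly_connected (kgraph m n k)"
proof (rule strongly_connectedI)
  have "replicate k m \<in> verts (kgraph m n k)"
    by (auto simp: kgraph_def words_def)
  then show "verts (kgraph m n k) \<noteq> {}"
    by blast
next
  fix t u assume "t \<in> verts (kgraph m n k)" "u \<in> verts (kgraph m n k)"
  then have t: "t \<in> words m n k" and u: "u \<in> words m n k"
    by (auto simp: kgraph_def)
  then have "word_reach m n t u"
    using \<open>odd (m + n)\<close> by (intro word_reach_all) (auto simp: words_def)
  then show "t \<rightarrow>\<^sup>*\<^bsub>kgraph m n k\<^esub> u"
    using kgraph_reachable[OF t] by (auto simp: word_reach_def)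
qed

end
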